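(* Let $X$ be a $T_1$ space and let $w=x_1^{\epsilon_1}x_2^{\epsilon_2}\ldots x_n^{\epsilon_n}$ be a reduced word in $\mathit{FP}_n(X)$, where $x_i\in X$ and $\epsilon_i=\pm 1$ for $i=1,2,\ldots,n$, and if $x_i=x_{i+1}$ for some $i=1,2,\ldots,n-1$ then $\epsilon_i=\epsilon_{i+1}$. Let $\mathscr{B}$ denote the collection of all sets of the form $U_1^{\epsilon_1}U_2^{\epsilon_2}\ldots U_n^{\epsilon_n}$, where for $i=1,2,\ldots,n$ the set $U_i$ is a neighbourhood of $x_i$ in $X$ when $\epsilon_i=1$ and $U_i=\{x_i\}$ when $\epsilon_i=-1$. Then $\mathscr{B}$ is a base for the neighbourhood system at $w$ in the subspace $\mathit{FP}_n(X)$ of $\mathit{FP}(X)$.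
   Context: A paratopological group is a group $G$ with a topology such that multiplication $G\times G\to G$ is continuous. (Inversion need not be continuous, and no separation axiom is assumed.) For a topological space $X$, the (Markov) free paratopological group $\mathit{FP}(X)$ on $X$ is a paratopological group that contains $X$ as a topological subspace, is generated algebraically by $X$, and is such that every continuous map $f:X\to H$ into an arbitrary paratopological group $H$ extends to a continuous homomorphism $\hat f:\mathit{FP}(X)\to H$. It exists for every space $X$, and its underlying abstract group is the free group $F_a(X)$ on the set $X$. $\mathit{FP}_n(X)$ denotes the subspace of $\mathit{FP}(X)$ consisting of all elements whose reduced word over $X\cup X^{-1}$ has length at most $n$. For subsets $A,B$ of a group, $AB=\{ab:a\in A,\ b\in B\}$, $A^{1}=A$ and $A^{-1}=\{a^{-1}:a\in A\}$. "$\mathscr{B}$ is a base for the neighbourhood system at $w$" means that every member of $\mathscr{B}$ is a (not necessarily open) neighbourhood of $w$ and every neighbourhood of $w$ contains a member of $\mathscr{B}$. *)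

theory Defs
  imports "HOL-Analysis.Analysis" "HOL-Algebra.Generated_Groups"
begin

definition paratopological_group :: "('b, 'm) monoid_scheme \<Rightarrow> 'b topology \<Rightarrow> bool" where
  "paratopological_group G T \<longleftrightarrow>
     group G \<and> topspace T = carrier G \<and>
     continuous_map (prod_topology T T) T (\<lambda>(x, y). x \<otimes>\<^bsub>G\<^esub> y)"

text \<open>A word is a list of letters \<open>(x, \<epsilon>)\<close>, standing for \<open>x\<close> to the power \<open>\<epsilon>\<close>,
  where \<open>\<epsilon>\<close> is \<open>1\<close> or \<open>-1\<close>.\<close>

type_synonym 'a word = "('a \<times> int) list"

definition reduced_word :: "'a topology \<Rightarrow> 'a word \<Rightarrow> bool" where
  "reduced_word X w \<longleftrightarrow>
     set w \<subseteq> topspace X \<times> {1, -1} \<and>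
     (\<forall>i. Suc i < length w \<longrightarrow> fst (w ! i) = fst (w ! Suc i) \<longrightarrow> snd (w ! i) = snd (w ! Suc i))"

definition word_value :: "('b, 'm) monoid_scheme \<Rightarrow> ('a \<Rightarrow> 'b) \<Rightarrow> 'a word \<Rightarrow> 'b" where
  "word_value G e w = foldr (\<lambda>(x, \<epsilon>) g. (e x [^]\<^bsub>G\<^esub> \<epsilon>) \<otimes>\<^bsub>G\<^esub> g) w \<one>\<^bsub>G\<^esub>"

text \<open>The group \<open>G\<close> with topology \<open>T\<close> is the (Markov) free paratopological group on \<open>X\<close>,
  the inclusion of \<open>X\<close> being \<open>e\<close>.  HOL cannot quantify over the carrier type of the test
  group \<open>H\<close>, so \<open>H\<close> ranges over all paratopological groups whose elements are taken from
  the type of words over \<open>X\<close>.  This loses nothing, because only the subgroup of \<open>H\<close> generated by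
  the image of \<open>f\<close> matters and its elements can be named by words: lemma
  \<open>free_paratopological_group_universal\<close> below gives the extension property for \<open>H\<close> over an
  arbitrary type.\<close>

definition free_paratopological_group ::
    "'a topology \<Rightarrow> ('b, 'm) monoid_scheme \<Rightarrow> 'b topology \<Rightarrow> ('a \<Rightarrow> 'b) \<Rightarrow> bool" where
  "free_paratopological_group X G T e \<longleftrightarrow>
     paratopological_group G T \<and>
     embedding_map X T e \<and>
     generate G (e ` topspace X) = carrier G \<and>
     (\<forall>(H :: 'a word monoid) S f.
        paratopological_group H S \<and> continuous_map X S f \<longrightarrow>
        (\<exists>h. h \<in> hom G H \<and> continuous_map T S h \<and> (\<forall>x \<in> topspace X. h (e x) = f x)))"

definition FP_level ::
    "'a topology \<Rightarrow> ('b, 'm) monoid_scheme \<Rightarrow> ('a \<Rightarrow> 'b) \<Rightarrow> nat \<Rightarrow> 'b set" where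
  "FP_level X G e n = {word_value G e w | w. reduced_word X w \<and> length w \<le> n}"

definition is_neighbourhood :: "'a topology \<Rightarrow> 'a \<Rightarrow> 'a set \<Rightarrow> bool" where
  "is_neighbourhood X p N \<longleftrightarrow> N \<subseteq> topspace X \<and> (\<exists>U. openin X U \<and> p \<in> U \<and> U \<subseteq> N)"

definition base_for_neighbourhood_system :: "'a topology \<Rightarrow> 'a \<Rightarrow> 'a set set \<Rightarrow> bool" where
  "base_for_neighbourhood_system X p \<B> \<longleftrightarrow>
     (\<forall>B \<in> \<B>. is_neighbourhood X p B) \<and>
     (\<forall>N. is_neighbourhood X p N \<longrightarrow> (\<exists>B \<in> \<B>. B \<subseteq> N))"

definition set_power :: "('b, 'm) monoid_scheme \<Rightarrow> 'b set \<Rightarrow> int \<Rightarrow> 'b set" where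
  "set_power G A \<epsilon> = (\<lambda>a. a [^]\<^bsub>G\<^esub> \<epsilon>) ` A"

definition set_list_product :: "('b, 'm) monoid_scheme \<Rightarrow> 'b set list \<Rightarrow> 'b set" where
  "set_list_product G As = foldr (\<lambda>A B. A <#>\<^bsub>G\<^esub> B) As {\<one>\<^bsub>G\<^esub>}"

text \<open>Positions are counted from \<open>0\<close>: the letter at position \<open>i\<close> is \<open>w ! i\<close>, with
  associated set \<open>U i\<close>.\<close>

definition word_neighbourhoods ::
    "'a topology \<Rightarrow> ('b, 'm) monoid_scheme \<Rightarrow> ('a \<Rightarrow> 'b) \<Rightarrow> 'a word \<Rightarrow> 'b set set" where
  "word_neighbourhoods X G e w =
     {set_list_product G (map (\<lambda>i. set_power G (e ` U i) (snd (w ! i))) [0..<length w]) | U.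
        \<forall>i < length w.
          (snd (w ! i) = 1 \<longrightarrow> is_neighbourhood X (fst (w ! i)) (U i)) \<and>
          (snd (w ! i) = -1 \<longrightarrow> U i = {fst (w ! i)})}"


lemma word_value_Nil: "word_value G e [] = \<one>\<^bsub>G\<^esub>"
  by (simp add: word_value_def)

lemma word_value_Cons:
  "word_value G e ((x, \<epsilon>) # w) = (e x [^]\<^bsub>G\<^esub> \<epsilon>) \<otimes>\<^bsub>G\<^esub> word_value G e w"
  by (simp add: word_value_def)

lemma word_value_closed:
  assumes "group G" "e ` A \<subseteq> carrier G" "set w \<subseteq> A \<times> B"
  shows "word_value G e w \<in> carrier G"
  using assms(3)
proof (induction w)
  case Nil
  then show ?case using assms(1) by (simp add: word_value_Nil group.is_monoid monoid.one_closed)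
next
  case (Cons a w)
  interpret group G by (fact assms(1))
  obtain x d where a: "a = (x, d)" by force
  have "e x \<in> carrier G" using Cons.prems assms(2) a by auto
  then show ?case using Cons a by (simp add: word_value_Cons)
qed

lemma word_value_append:
  assumes "group G" "e ` A \<subseteq> carrier G" "set v \<subseteq> A \<times> B" "set w \<subseteq> A \<times> B"
  shows "word_value G e (v @ w) = word_value G e v \<otimes>\<^bsub>G\<^esub> word_value G e w"
  using assms(3)
proof (induction v)
  interpret group G by (fact assms(1))
  case Nil
  then show ?case using word_value_closed[OF assms(1,2,4)] by (simp add: word_value_Nil)
next
  case (Cons a v)
  interpret group G by (fact assms(1))
  obtain x d where a: "a = (x, d)" by force
  have x: "e x \<in> carrier G" using Cons.prems assms(2) a by auto
  have v: "set v \<subseteq> A \<times> B" using Cons.prems by auto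
  show ?case using Cons.IH[OF v] a x word_value_closed[OF assms(1,2) v]
      word_value_closed[OF assms(1,2,4)]
    by (simp add: word_value_Cons m_assoc)
qed

lemma generate_subset_word_values:
  assumes "group G" "e ` A \<subseteq> carrier G"
  shows "generate G (e ` A) \<subseteq> word_value G e ` {w. set w \<subseteq> A \<times> {1, -1}}"
proof
  interpret group G by (fact assms(1))
  fix g assume "g \<in> generate G (e ` A)"
  then show "g \<in> word_value G e ` {w. set w \<subseteq> A \<times> {1, -1}}"
  proof induction
    case one
    show ?case by (rule image_eqI[of _ _ "[]"]) (auto simp: word_value_Nil)
  next
    case (incl h)
    then obtain x where x: "x \<in> A" "h = e x" by blast
    with assms(2) have "e x \<in> carrier G" by auto
    with x show ?case
      by (intro image_eqI[of _ _ "[(x, 1)]"]) (auto simp: word_value_Nil word_value_Cons)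
  next
    case (inv h)
    then obtain x where x: "x \<in> A" "h = e x" by blast
    with assms(2) have "e x \<in> carrier G" by auto
    with x show ?case
      by (intro image_eqI[of _ _ "[(x, -1)]"])
        (auto simp: word_value_Nil word_value_Cons int_pow_neg)
  next
    case (eng h1 h2)
    then obtain v w where "set v \<subseteq> A \<times> {1, -1}" "h1 = word_value G e v"
      "set w \<subseteq> A \<times> {1, -1}" "h2 = word_value G e w" by blast
    then show ?case using word_value_append[OF assms, of v "{1,-1}" w]
      by (intro image_eqI[of _ _ "v @ w"]) auto
  qed
qed

theorem free_paratopological_group_universal:
  fixes X :: "'a topology" and G :: "('b, 'm) monoid_scheme" and H :: "('c, 'k) monoid_scheme"
  assumes free: "free_paratopological_group X G T e"
    and H: "paratopological_group H S"
    and f: "continuous_map X S f"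
  shows "\<exists>h. h \<in> hom G H \<and> continuous_map T S h \<and> (\<forall>x \<in> topspace X. h (e x) = f x)"
proof -
  interpret H: group H using H by (simp add: paratopological_group_def)
  have topS: "topspace S = carrier H" using H by (simp add: paratopological_group_def)
  have contH: "continuous_map (prod_topology S S) S (\<lambda>(x, y). x \<otimes>\<^bsub>H\<^esub> y)"
    using H by (simp add: paratopological_group_def)
  have fim: "f ` topspace X \<subseteq> carrier H"
    using f topS by (simp add: continuous_map_def image_subset_iff_funcset)
  define K where "K = generate H (f ` topspace X)"
  have subK: "subgroup K H" unfolding K_def by (rule H.generate_is_subgroup[OF fim])
  define val where "val = word_value H f"
  define nm where "nm = inv_into {w. set w \<subseteq> topspace X \<times> {1, -1}} val"
  have val_nm: "val (nm k) = k" if "k \<in> K" for k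
    using generate_subset_word_values[OF H.is_group fim] that
    unfolding nm_def val_def K_def by (intro f_inv_into_f) blast
  define H' :: "'a word monoid" where
    "H' = \<lparr>carrier = nm ` K, mult = (\<lambda>a b. nm (val a \<otimes>\<^bsub>H\<^esub> val b)), one = nm \<one>\<^bsub>H\<^esub>\<rparr>"
  define S' where "S' = pullback_topology (nm ` K) val S"
  have Kc: "k \<in> carrier H" if "k \<in> K" for k using subgroup.mem_carrier[OF subK that] .
  have Km: "k \<otimes>\<^bsub>H\<^esub> l \<in> K" if "k \<in> K" "l \<in> K" for k l
    using subgroup.m_closed[OF subK that] .
  have K1: "\<one>\<^bsub>H\<^esub> \<in> K" using subgroup.one_closed[OF subK] .
  have Ki: "inv\<^bsub>H\<^esub> k \<in> K" if "k \<in> K" for k using subgroup.m_inv_closed[OF subK that] .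
  have "group H'"
  proof (rule groupI)
    fix a assume "a \<in> carrier H'"
    then obtain k where k: "k \<in> K" "a = nm k" by (auto simp: H'_def)
    then show "\<exists>b\<in>carrier H'. b \<otimes>\<^bsub>H'\<^esub> a = \<one>\<^bsub>H'\<^esub>"
      by (intro bexI[of _ "nm (inv\<^bsub>H\<^esub> k)"]) (auto simp: H'_def val_nm Ki Kc)
  qed (auto simp: H'_def val_nm Km K1 Kc H.m_assoc)
  have topS': "topspace S' = nm ` K"
    unfolding S'_def topspace_pullback_topology by (auto simp: topS val_nm Kc)
  have valcont: "continuous_map S' S val"
    using continuous_map_pullback[of S S id "nm ` K" val] by (simp add: S'_def)
  have "continuous_map (prod_topology S' S') S' (\<lambda>(x, y). x \<otimes>\<^bsub>H'\<^esub> y)"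
  proof -
    have "continuous_map (prod_topology S' S') (prod_topology S S) (\<lambda>p. (val (fst p), val (snd p)))"
      by (intro continuous_map_pairedI continuous_map_compose[OF continuous_map_fst valcont, unfolded o_def]
          continuous_map_compose[OF continuous_map_snd valcont, unfolded o_def])
    from continuous_map_compose[OF this contH]
    have c: "continuous_map (prod_topology S' S') S (\<lambda>p. val (fst p) \<otimes>\<^bsub>H\<^esub> val (snd p))"
      by (simp add: o_def)
    have "continuous_map (prod_topology S' S') S (val \<circ> (\<lambda>(x, y). x \<otimes>\<^bsub>H'\<^esub> y))"
      by (rule continuous_map_eq[OF c]) (auto simp: topS' H'_def val_nm Km)
    then show ?thesis
    proof (rule continuous_map_pullback'[of "prod_topology S' S'" S val _ "nm ` K", folded S'_def])
      show "topspace (prod_topology S' S') \<subseteq> (\<lambda>(x, y). x \<otimes>\<^bsub>H'\<^esub> y) -` (nm ` K)"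
        by (auto simp: topS' H'_def val_nm Km)
    qed
  qed
  with \<open>group H'\<close> topS' have pH': "paratopological_group H' S'"
    by (simp add: paratopological_group_def H'_def)
  have fK: "f x \<in> K" if "x \<in> topspace X" for x
    unfolding K_def using that by (intro generate.incl) auto
  have "continuous_map X S' (nm \<circ> f)"
    unfolding S'_def
  proof (rule continuous_map_pullback')
    show "continuous_map X S (val \<circ> (nm \<circ> f))"
      by (rule continuous_map_eq[OF f]) (auto simp: val_nm fK)
    show "topspace X \<subseteq> (nm \<circ> f) -` nm ` K" using fK by auto
  qed
  then obtain h where h: "h \<in> hom G H'" "continuous_map T S' h"
      "\<forall>x \<in> topspace X. h (e x) = (nm \<circ> f) x"
    using free pH' unfolding free_paratopological_group_def by blast
  have "val \<circ> h \<in> hom G H"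
  proof (rule homI)
    fix x assume "x \<in> carrier G"
    then have "h x \<in> nm ` K" using h(1) by (auto simp: hom_def H'_def)
    then show "(val \<circ> h) x \<in> carrier H" by (auto simp: val_nm Kc)
  next
    fix x y assume xy: "x \<in> carrier G" "y \<in> carrier G"
    then have "h x \<in> nm ` K" "h y \<in> nm ` K" using h(1) by (auto simp: hom_def H'_def)
    moreover have "h (x \<otimes>\<^bsub>G\<^esub> y) = nm (val (h x) \<otimes>\<^bsub>H\<^esub> val (h y))"
      using h(1) xy by (simp add: hom_def H'_def)
    ultimately show "(val \<circ> h) (x \<otimes>\<^bsub>G\<^esub> y) = (val \<circ> h) x \<otimes>\<^bsub>H\<^esub> (val \<circ> h) y"
      by (auto simp: val_nm Km)
  qed
  moreover have "continuous_map T S (val \<circ> h)"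
    by (rule continuous_map_compose[OF h(2) valcont])
  moreover have "\<forall>x \<in> topspace X. (val \<circ> h) (e x) = f x"
    using h(3) by (auto simp: val_nm fK)
  ultimately show ?thesis by blast
qed

end

theory Submission
  imports Defs
begin

text \<open>
  A preorder on \<open>X\<close> all of whose up-sets \<open>{y. x \<le> y}\<close> are open induces a preorder on the free
  group: one may insert \<open>a b\<close> when \<open>a\<inverse> \<le> b\<close> and delete \<open>a b\<close> when \<open>a \<le> b\<inverse>\<close>. Dividing by the
  associated equivalence and giving the quotient the topology of up-sets yields a
  paratopological group to which \<open>X\<close> maps continuously, so the elements of the free
  paratopological group above \<open>w\<close> form an open set. Deletions commute with insertions up to
  replacing single letters; hence, if \<open>w\<close> admits no deletion, each word above \<open>w\<close> arises from \<open>w\<close>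
  by raising letters and then inserting pairs, and the words of length at most \<open>n\<close> arise by
  raising letters only. Given open sets \<open>V\<^sub>i\<close> around the \<open>x\<^sub>i\<close> with \<open>\<epsilon>\<^sub>i = 1\<close>, let \<open>x \<le> y\<close> mean that
  \<open>y\<close> lies in each \<open>V\<^sub>i\<close> containing \<open>x\<close> and is not one of the \<open>x\<^sub>i\<close> unless \<open>y = x\<close>. The up-sets are
  open because \<open>X\<close> is \<open>T\<^sub>1\<close>, and since no point lies strictly below a letter of \<open>w\<close>, the reduced
  word \<open>w\<close> admits no deletion and its inverse letters cannot be raised.
\<close>

section \<open>Words over a preordered alphabet with involution\<close>

locale involutive_preorder =
  fixes le :: "'l \<Rightarrow> 'l \<Rightarrow> bool" and iv :: "'l \<Rightarrow> 'l"
  assumes le_refl: "le a a"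
    and le_trans: "le a b \<Longrightarrow> le b c \<Longrightarrow> le a c"
    and iv_iv: "iv (iv a) = a"
    and iv_antimono: "le a b \<Longrightarrow> le (iv b) (iv a)"
begin

text \<open>An insertion expresses 1 \<le> a b and a deletion a b \<le> 1. For
  \<open>b = iv a\<close> both are allowed by reflexivity, so free reduction is part of the relation
  and words need not be reduced.\<close>

inductive below :: "'l list \<Rightarrow> 'l list \<Rightarrow> bool" for p where
  refl: "below p p"
| insert: "below p (u @ v) \<Longrightarrow> le (iv a) b \<Longrightarrow> below p (u @ [a, b] @ v)"
| delete: "below p (u @ [a, b] @ v) \<Longrightarrow> le a (iv b) \<Longrightarrow> below p (u @ v)"

lemma below_trans:
  assumes "below q r" "below p q"
  shows "below p r"
  using assms
proof induction
  case (insert u v a b)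
  then show ?case by (blast intro: below.insert)
next
  case (delete u a b v)
  then show ?case using below.delete by blast
qed

lemma below_context:
  assumes "below p q"
  shows "below (s @ p @ t) (s @ q @ t)"
  using assms
proof induction
  case refl
  show ?case by (rule below.refl)
next
  case (insert u v a b)
  then show ?case using below.insert[of "s @ p @ t" "s @ u" "v @ t" a b] by simp
next
  case (delete u a b v)
  then show ?case using below.delete[of "s @ p @ t" "s @ u" a b "v @ t"] by simp
qed

lemma below_append:
  assumes "below p p'" "below q q'"
  shows "below (p @ q) (p' @ q')"
proof (rule below_trans)
  show "below (p' @ q) (p' @ q')" using below_context[OF assms(2), of p' "[]"] by simp
  show "below (p @ q) (p' @ q)" using below_context[OF assms(1), of "[]" q] by simp
qed

lemma below_single:
  assumes "le a b"
  shows "below [a] [b]"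
proof -
  \<comment> \<open>The route from \<open>a\<close> to \<open>b\<close> passes through the word
    \<open>a (iv a) b\<close>: the pair inserted on the right is allowed by a \<le> b, and then
    \<open>a\<close> cancels with \<open>iv a\<close>.\<close>
  have "below [a] ([a] @ [iv a, b] @ [])"
    using below.insert[of "[a]" "[a]" "[]" "iv a" b] assms by (simp add: iv_iv below.refl)
  then show ?thesis
    using below.delete[of "[a]" "[]" a "iv a" "[b]"] by (simp add: iv_iv le_refl)
qed

definition inv_list :: "'l list \<Rightarrow> 'l list" where
  "inv_list p = rev (map iv p)"

lemma inv_list_cancel:
  "below [] (inv_list p @ p)" "below (inv_list p @ p) []"
proof (induction p)
  case Nil
  {
    case 1 show ?case by (simp add: inv_list_def below.refl)
  next
    case 2 show ?case by (simp add: inv_list_def below.refl)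
  }
next
  case (Cons a p)
  {
    case 1
    show ?case using below.insert[OF Cons.IH(1), of "iv a" a]
      by (simp add: inv_list_def iv_iv le_refl)
  next
    case 2
    show ?case
      using below_trans[OF Cons.IH(2) below.delete[of _ "inv_list p" "iv a" a p, OF below.refl]]
      by (simp add: inv_list_def le_refl)
  }
qed

text \<open>The normal form to which chains of \<open>below\<close> are brought when they start at a
  word without deletions: all raising comes first, all insertions afterwards.\<close>

inductive raised :: "'l list \<Rightarrow> 'l list \<Rightarrow> bool" for w where
  letters: "list_all2 le w v \<Longrightarrow> raised w v"
| insert: "raised w (u @ v) \<Longrightarrow> le (iv a) b \<Longrightarrow> raised w (u @ [a, b] @ v)"

text \<open>Raising the letters of an inserted pair keeps the insertion legal, since iv a' \<le> iv
  a \<le> b \<le> b'. Late raising is thus absorbed by the initial step and by the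
  insertions.\<close>

lemma raised_mono:
  assumes "raised w v" "list_all2 le v v'"
  shows "raised w v'"
  using assms
proof (induction arbitrary: v')
  case (letters v)
  then show ?case
    by (intro raised.letters) (rule list_all2_trans[of le le le, OF le_trans])
next
  case (insert u v a b)
  from insert.prems obtain u' r where "v' = u' @ r" "list_all2 le u u'" "list_all2 le (a # b # v) r"
    by (force simp: list_all2_append1[of le u])
  moreover from this(3) obtain a' b' v'' where "r = a' # b' # v''" "le a a'" "le b b'" "list_all2 le v v''"
    unfolding list_all2_Cons1 by blast
  ultimately have v': "v' = u' @ [a', b'] @ v''"
    and le: "list_all2 le u u'" "le a a'" "le b b'" "list_all2 le v v''"
    by simp_all
  have "raised w (u' @ v'')"
    using insert.IH le by (simp add: list_all2_appendI)
  moreover have "le (iv a') b'"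
    using le insert.hyps iv_antimono le_trans by blast
  ultimately show ?case unfolding v' by (rule raised.insert)
qed

text \<open>The induction step is the commutation of the deletion of \<open>c d\<close> with the insertion of \<open>a b\<close>;
  when the two pairs share one letter, the net effect is to raise a letter.\<close>

lemma raised_delete:
  assumes "raised w v" "v = s @ [c, d] @ t" "le c (iv d)"
    and irred: "\<And>s c d t. w = s @ [c, d] @ t \<Longrightarrow> \<not> le c (iv d)"
  shows "raised w (s @ t)"
  using assms(1-3)
proof (induction arbitrary: s t)
  case (letters v)
  then obtain s' c' d' t' where "w = s' @ [c', d'] @ t'" "le c' c" "le d' d"
    by (auto simp: list_all2_append2 list_all2_Cons2)
  \<comment> \<open>A deletion in \<open>v\<close> would pull back to \<open>w\<close>, because c'
    \<le> c \<le> iv d \<le> iv d'.\<close>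
  with irred letters.prems(2) iv_antimono le_trans show ?case by metis
next
  case (insert u v a b)
  have mono: "raised w (u' @ v')" if "list_all2 le u u'" "list_all2 le v v'" for u' v'
    using raised_mono[OF insert.hyps(1)] that by (simp add: list_all2_appendI)
  have le_same: "list_all2 le x x" for x
    by (simp add: list_all2_refl le_refl)
  have eq: "u @ a # b # v = s @ c # d # t" using insert.prems by simp
  \<comment> \<open>If the pairs overlap on the left, c \<le> iv a \<le> b, so the surviving
    \<open>b\<close> is a raised \<open>c\<close>. If they overlap on the right, iv a \<le> b \<le>
    iv d gives d \<le> a, so the surviving \<open>a\<close> is a raised \<open>d\<close>.\<close>
  consider (left) r where "u = s @ [c, d] @ r" "t = r @ [a, b] @ v"
    | (left_overlap) "u = s @ [c]" "d = a" "t = b # v"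
    | (same) "u = s" "t = v"
    | (right_overlap) "s = u @ [a]" "c = b" "v = d # t"
    | (right) r where "s = u @ [a, b] @ r" "v = r @ [c, d] @ t"
    using eq by (auto simp: append_eq_append_conv2 append_eq_Cons_conv Cons_eq_append_conv)
  then show ?case
  proof cases
    case left
    then have "raised w (s @ r @ v)" using insert.IH[of s "r @ v"] insert.prems by simp
    then show ?thesis using raised.insert[of w "s @ r" v a b] insert.hyps left by simp
  next
    case left_overlap
    then have "le c b" using insert.hyps insert.prems le_trans by blast
    then show ?thesis using mono[of "s @ [b]" v] left_overlap le_same
      by (simp add: list_all2_appendI)
  next
    case same
    then show ?thesis using insert.hyps by simp
  next
    case right_overlap
    then have "le d a"
      using insert.hyps insert.prems iv_antimono iv_iv le_trans by metis
    then show ?thesis using mono[of u "a # t"] right_overlap le_same by simp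
  next
    case right
    then have "raised w (u @ r @ t)" using insert.IH[of "u @ r" t] insert.prems by simp
    then show ?thesis using raised.insert[of w u "r @ t" a b] insert.hyps right by simp
  qed
qed

text \<open>Insertions preserve the normal form and \<open>raised_delete\<close> absorbs each
  deletion, so irreducibility is demanded of \<open>w\<close> alone and not of the words along the
  chain.\<close>

lemma below_raised:
  assumes "below w v"
    and irred: "\<And>s c d t. w = s @ [c, d] @ t \<Longrightarrow> \<not> le c (iv d)"
  shows "raised w v"
  using assms(1)
proof induction
  case refl
  show ?case by (intro raised.letters) (simp add: list_all2_refl le_refl)
next
  case (insert u v a b)
  then show ?case by (intro raised.insert)
next
  case (delete u a b v)
  then show ?case using raised_delete[OF _ HOL.refl] irred by blast
qed

lemma raised_length:
  assumes "raised w v"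
  shows "length w < length v \<or> list_all2 le w v"
  using assms
  by induction (auto dest: list_all2_lengthD)

text \<open>An insertion adds two letters, so a word no longer than \<open>w\<close> can only have
  arisen by raising.\<close>

lemma below_short:
  assumes "below w v" "length v \<le> length w"
    and "\<And>s c d t. w = s @ [c, d] @ t \<Longrightarrow> \<not> le c (iv d)"
  shows "list_all2 le w v"
  using raised_length[OF below_raised[OF assms(1,3)]] assms(2) by auto

section \<open>The ordered group of words\<close>

text \<open>Up-sets stand in for classes of words: two words lie below each other exactly when their
  up-sets agree, so no quotient has to be formed.\<close>

definition up :: "'l list \<Rightarrow> 'l list set" where
  "up p = {q. below p q}"

lemma up_subset_iff: "up q \<subseteq> up p \<longleftrightarrow> below p q"
  unfolding up_def using below.refl below_trans by blast

lemma up_eqI: "below p q \<Longrightarrow> below q p \<Longrightarrow> up p = up q"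
  by (simp add: set_eq_subset up_subset_iff)

text \<open>Closing all concatenations upwards avoids a choice of representatives; by
  \<open>mult_up\<close> the product is induced by concatenation.\<close>

definition word_group :: "'l list set monoid" where
  "word_group = \<lparr>carrier = range up,
     mult = (\<lambda>A B. {r. \<exists>a\<in>A. \<exists>b\<in>B. below (a @ b) r}), one = up []\<rparr>"

lemma carrier_word_group: "carrier word_group = range up"
  and one_word_group: "\<one>\<^bsub>word_group\<^esub> = up []"
  by (simp_all add: word_group_def)

lemma mult_up: "up p \<otimes>\<^bsub>word_group\<^esub> up q = up (p @ q)"
proof -
  have "\<exists>a. below p a \<and> (\<exists>b. below q b \<and> below (a @ b) r)" if "below (p @ q) r" for r
    using that below.refl by blast
  then show ?thesis
    unfolding word_group_def up_def using below_append below_trans by auto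
qed

lemma mult_word_group_mono:
  "A \<subseteq> A' \<Longrightarrow> B \<subseteq> B' \<Longrightarrow> A \<otimes>\<^bsub>word_group\<^esub> B \<subseteq> A' \<otimes>\<^bsub>word_group\<^esub> B'"
  unfolding word_group_def by auto

lemma up_inv_list: "up (inv_list p @ p) = up []"
  using inv_list_cancel by (rule up_eqI[OF _ _, rotated])

lemma group_word_group: "group word_group"
proof (rule groupI)
  fix A assume "A \<in> carrier word_group"
  then obtain p where "A = up p" by (auto simp: carrier_word_group)
  then show "\<exists>B\<in>carrier word_group. B \<otimes>\<^bsub>word_group\<^esub> A = \<one>\<^bsub>word_group\<^esub>"
    by (intro bexI[of _ "up (inv_list p)"])
      (auto simp: carrier_word_group one_word_group mult_up up_inv_list)
qed (auto simp: carrier_word_group one_word_group mult_up)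

lemma inv_up: "inv\<^bsub>word_group\<^esub> up p = up (inv_list p)"
proof -
  interpret group word_group by (rule group_word_group)
  show ?thesis
    by (rule inv_equality) (auto simp: mult_up one_word_group carrier_word_group up_inv_list)
qed

text \<open>A larger word has a smaller set \<open>up\<close>, so the up-sets of the order are the families that
  are closed under passing to subsets.\<close>

definition word_topology :: "'l list set topology" where
  "word_topology = topology (\<lambda>W. W \<subseteq> range up \<and> (\<forall>A\<in>W. \<forall>B\<in>range up. B \<subseteq> A \<longrightarrow> B \<in> W))"

lemma openin_word_topology:
  "openin word_topology W \<longleftrightarrow> W \<subseteq> range up \<and> (\<forall>A\<in>W. \<forall>B\<in>range up. B \<subseteq> A \<longrightarrow> B \<in> W)"
proof -
  have "istopology (\<lambda>W. W \<subseteq> range up \<and> (\<forall>A\<in>W. \<forall>B\<in>range up. B \<subseteq> A \<longrightarrow> B \<in> W))"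
    (is "istopology ?P")
    unfolding istopology_def
  proof (rule conjI; intro allI impI)
    show "?P (S \<inter> T)" if "?P S" "?P T" for S T using that by auto
    fix K assume K: "\<forall>S\<in>K. ?P S"
    show "?P (\<Union>K)"
    proof (intro conjI ballI impI)
      fix A B assume "A \<in> \<Union>K" and B: "B \<in> range up" "B \<subseteq> A"
      then obtain S where "S \<in> K" "A \<in> S" by blast
      with K B have "B \<in> S" by auto
      with \<open>S \<in> K\<close> show "B \<in> \<Union>K" by blast
    qed (use K in auto)
  qed
  from topology_inverse'[OF this] show ?thesis by (simp add: word_topology_def)
qed

lemma topspace_word_topology: "topspace word_topology = range up"
proof (rule antisym)
  show "topspace word_topology \<subseteq> range up"
    using openin_topspace[of word_topology] unfolding openin_word_topology by (rule conjunct1)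
  show "range up \<subseteq> topspace word_topology"
    by (rule openin_subset) (auto simp: openin_word_topology)
qed

lemma openin_up: "openin word_topology {B \<in> range up. B \<subseteq> A}"
  by (auto simp: openin_word_topology)

lemma paratopological_word_group: "paratopological_group word_group word_topology"
proof -
  let ?m = "\<lambda>(A, B). A \<otimes>\<^bsub>word_group\<^esub> B"
  have closed: "?m P \<in> range up" if "P \<in> range up \<times> range up" for P
    using that by (auto simp: mult_up)
  have "openin (prod_topology word_topology word_topology) {P \<in> range up \<times> range up. ?m P \<in> W}"
    (is "openin _ ?S") if W: "openin word_topology W" for W
  proof (subst openin_prod_topology_alt, intro allI impI)
    fix A B assume AB: "(A, B) \<in> ?S"
    \<comment> \<open>\<open>?D A\<close> is the smallest open set containing \<open>A\<close>, so
      continuity reduces to monotonicity of the product.\<close>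
    let ?D = "\<lambda>A. {B \<in> range up. B \<subseteq> A}"
    have "?D A \<times> ?D B \<subseteq> ?S"
    proof
      fix P assume P: "P \<in> ?D A \<times> ?D B"
      then have "?m P \<subseteq> ?m (A, B)" by (auto dest: mult_word_group_mono)
      moreover have "?m P \<in> range up" using P by (intro closed) auto
      ultimately show "P \<in> ?S" using W AB P by (auto simp: openin_word_topology)
    qed
    then show "\<exists>U V. openin word_topology U \<and> openin word_topology V \<and> A \<in> U \<and> B \<in> V \<and> U \<times> V \<subseteq> ?S"
      using AB by (intro exI[of _ "?D A"] exI[of _ "?D B"]) (auto simp: openin_up)
  qed
  then have "continuous_map (prod_topology word_topology word_topology) word_topology ?m"
    using closed by (auto simp: continuous_map_def topspace_word_topology Pi_def)
  then show ?thesis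
    by (simp add: paratopological_group_def group_word_group topspace_word_topology
        carrier_word_group)
qed

end

section \<open>Values of words\<close>

text \<open>Letters chosen from the factors of a basic set may cancel, so their words need not be
  reduced. A failure of reducedness is an adjacent pair with opposite signs; cancelling it shortens
  the word and keeps its value.\<close>

lemma word_value_in_level:
  assumes "group G" "e ` topspace X \<subseteq> carrier G"
    and "set v \<subseteq> topspace X \<times> {1, -1}" "length v \<le> n"
  shows "word_value G e v \<in> FP_level X G e n"
  using assms(3,4)
proof (induction "length v" arbitrary: v rule: less_induct)
  case less
  interpret group G by (fact assms(1))
  show ?case
  proof (cases "reduced_word X v")
    case True
    with less.prems show ?thesis unfolding FP_level_def by blast
  next
    case False
    then obtain i where i: "Suc i < length v" "fst (v ! i) = fst (v ! Suc i)"
        "snd (v ! i) \<noteq> snd (v ! Suc i)"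
      using less.prems unfolding reduced_word_def by blast
    define s t where "s = take i v" and "t = drop (Suc (Suc i)) v"
    obtain x d d' where xd: "v ! i = (x, d)" "v ! Suc i = (x, d')" "d \<noteq> d'"
      using i by (metis prod.collapse)
    have v: "v = s @ [(x, d), (x, d')] @ t"
      unfolding s_def t_def using i(1) xd
      by (metis Cons_nth_drop_Suc Suc_lessD append_Cons append_Nil append_take_drop_id)
    have st: "set s \<subseteq> topspace X \<times> {1, -1}" "set t \<subseteq> topspace X \<times> {1, -1}"
      and x: "x \<in> topspace X" and d: "d \<in> {1, -1}" "d' \<in> {1, -1}"
      using less.prems(1) unfolding v by auto
    have ex: "e x \<in> carrier G" using assms(2) x by auto
    have t: "word_value G e t \<in> carrier G"
      by (rule word_value_closed[OF assms(1,2) st(2)])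
    have "word_value G e ([(x, d), (x, d')] @ t)
        = (e x [^]\<^bsub>G\<^esub> d \<otimes>\<^bsub>G\<^esub> e x [^]\<^bsub>G\<^esub> d') \<otimes>\<^bsub>G\<^esub> word_value G e t"
      using ex t by (simp add: word_value_Cons m_assoc)
    also have "e x [^]\<^bsub>G\<^esub> d \<otimes>\<^bsub>G\<^esub> e x [^]\<^bsub>G\<^esub> d' = \<one>\<^bsub>G\<^esub>"
      using d xd(3) ex by (auto simp flip: int_pow_mult)
    finally have "word_value G e v = word_value G e (s @ t)"
      using t d x st word_value_append[OF assms(1,2), of s "{1, -1}" "[(x, d), (x, d')] @ t"]
        word_value_append[OF assms(1,2), of s "{1, -1}" t] unfolding v by auto
    then show ?thesis using less.hyps[of "s @ t"] less.prems(2) st by (auto simp: v)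
  qed
qed

text \<open>This allows the members of the base to be handled through words with the signs of
  \<open>w\<close>. Both sides nest products to the right and end with the unit, so induction
  matches them letter by letter.\<close>

lemma set_list_product_word_values:
  "set_list_product G (map (\<lambda>i. set_power G (e ` U i) (snd (w ! i))) [0..<length w])
     = word_value G e ` {v. length v = length w \<and>
         (\<forall>i<length w. snd (v ! i) = snd (w ! i) \<and> fst (v ! i) \<in> U i)}"
proof (induction w arbitrary: U)
  case Nil
  then show ?case by (simp add: set_list_product_def word_value_Nil)
next
  case (Cons a w)
  let ?V = "\<lambda>U w. {v. length v = length w \<and>
         (\<forall>i<length w. snd (v ! i) = snd (w ! i) \<and> fst (v ! i) \<in> U i)}"
  have V: "?V U (a # w) = {(x, snd a) # v | x v. x \<in> U 0 \<and> v \<in> ?V (U \<circ> Suc) w}"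
    by (auto simp: length_Suc_conv All_less_Suc2)
  have "set_list_product G (map (\<lambda>i. set_power G (e ` U i) (snd ((a # w) ! i))) [0..<length (a # w)])
      = set_power G (e ` U 0) (snd a) <#>\<^bsub>G\<^esub>
        set_list_product G (map (\<lambda>i. set_power G (e ` (U \<circ> Suc) i) (snd (w ! i))) [0..<length w])"
    by (simp add: set_list_product_def upt_conv_Cons o_def flip: map_Suc_upt del: upt_Suc)
  also have "\<dots> = set_power G (e ` U 0) (snd a) <#>\<^bsub>G\<^esub> word_value G e ` ?V (U \<circ> Suc) w"
    by (simp only: Cons.IH)
  also have "\<dots> = word_value G e ` ?V U (a # w)"
    unfolding V set_mult_def set_power_def
    by (auto simp: word_value_Cons image_iff) (metis word_value_Cons)+
  finally show ?case .
qed

text \<open>Splitting off the first letter reduces the claim to continuity of multiplication at one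
  pair. Inverse letters stay fixed because inversion need not be continuous.\<close>

lemma word_value_continuity:
  fixes X :: "'a topology" and w :: "'a word"
  assumes P: "paratopological_group G T" and e: "continuous_map X T e"
    and "openin T N" "word_value G e w \<in> N" "set w \<subseteq> topspace X \<times> {1, -1}"
  obtains U where
    "\<forall>i<length w. (snd (w ! i) = 1 \<longrightarrow> is_neighbourhood X (fst (w ! i)) (U i)) \<and>
       (snd (w ! i) = -1 \<longrightarrow> U i = {fst (w ! i)})"
    "\<forall>v. length v = length w \<and> (\<forall>i<length w. snd (v ! i) = snd (w ! i) \<and> fst (v ! i) \<in> U i)
       \<longrightarrow> word_value G e v \<in> N"
  using assms(3-5)
proof (induction w arbitrary: N thesis)
  case Nil
  then show ?case by (simp add: word_value_Nil)
next
  case (Cons a w)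
  interpret group G using P by (simp add: paratopological_group_def)
  have T: "topspace T = carrier G"
    and m: "continuous_map (prod_topology T T) T (\<lambda>(x, y). x \<otimes>\<^bsub>G\<^esub> y)"
    using P by (auto simp: paratopological_group_def)
  have ec: "e ` topspace X \<subseteq> carrier G"
    using e T by (auto simp: continuous_map_def)
  obtain x d where a: "a = (x, d)" by force
  have x: "x \<in> topspace X" and d: "d \<in> {1, -1}" and w: "set w \<subseteq> topspace X \<times> {1, -1}"
    using Cons.prems a by auto
  let ?g = "word_value G e w"
  have g: "?g \<in> carrier G" by (rule word_value_closed[OF is_group ec w])
  have ex: "e x \<in> carrier G" using ec x by auto
  have "openin (prod_topology T T) {p \<in> topspace (prod_topology T T). (\<lambda>(x, y). x \<otimes>\<^bsub>G\<^esub> y) p \<in> N}"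
    by (rule openin_continuous_map_preimage[OF m Cons.prems(2)])
  moreover have "(e x [^]\<^bsub>G\<^esub> d, ?g) \<in> {p \<in> topspace (prod_topology T T). (\<lambda>(x, y). x \<otimes>\<^bsub>G\<^esub> y) p \<in> N}"
    using Cons.prems(3) g ex a by (auto simp: T word_value_Cons)
  ultimately obtain P Q where PQ: "openin T P" "openin T Q" "e x [^]\<^bsub>G\<^esub> d \<in> P" "?g \<in> Q"
    "P \<times> Q \<subseteq> {p \<in> topspace (prod_topology T T). (\<lambda>(x, y). x \<otimes>\<^bsub>G\<^esub> y) p \<in> N}"
    unfolding openin_prod_topology_alt by meson
  obtain U where U:
    "\<forall>i<length w. (snd (w ! i) = 1 \<longrightarrow> is_neighbourhood X (fst (w ! i)) (U i)) \<and>
       (snd (w ! i) = -1 \<longrightarrow> U i = {fst (w ! i)})"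
    "\<forall>v. length v = length w \<and> (\<forall>i<length w. snd (v ! i) = snd (w ! i) \<and> fst (v ! i) \<in> U i)
       \<longrightarrow> word_value G e v \<in> Q"
    using Cons.IH[OF _ PQ(2,4) w] by blast
  define U0 where "U0 = (if d = 1 then {y \<in> topspace X. e y \<in> P} else {x})"
  have U0P: "e y [^]\<^bsub>G\<^esub> d \<in> P" if "y \<in> U0" for y
    using that PQ(3) ec d by (auto simp: U0_def split: if_splits)
  have U0n: "is_neighbourhood X x U0" if "d = 1"
  proof -
    have "openin X {y \<in> topspace X. e y \<in> P}"
      by (rule openin_continuous_map_preimage[OF e PQ(1)])
    then show ?thesis using that x PQ(3) ex unfolding is_neighbourhood_def U0_def by auto
  qed
  show ?case
  \<comment> \<open>\<open>case_nat\<close> puts \<open>U0\<close> at position 0 and shifts the sets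
    of the tail by one.\<close>
  proof (rule Cons.prems(1)[of "case_nat U0 U"])
    show "\<forall>i<length (a # w).
        (snd ((a # w) ! i) = 1 \<longrightarrow> is_neighbourhood X (fst ((a # w) ! i)) (case_nat U0 U i)) \<and>
        (snd ((a # w) ! i) = -1 \<longrightarrow> case_nat U0 U i = {fst ((a # w) ! i)})"
      using U(1) U0n by (auto simp: a All_less_Suc2 U0_def)
    show "\<forall>v. length v = length (a # w) \<and> (\<forall>i<length (a # w).
        snd (v ! i) = snd ((a # w) ! i) \<and> fst (v ! i) \<in> case_nat U0 U i) \<longrightarrow> word_value G e v \<in> N"
    proof (intro allI impI)
      fix v assume v: "length v = length (a # w) \<and> (\<forall>i<length (a # w).
          snd (v ! i) = snd ((a # w) ! i) \<and> fst (v ! i) \<in> case_nat U0 U i)"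
      obtain y d' v' where v': "v = (y, d') # v'" "length v' = length w"
        using v by (auto simp: length_Suc_conv)
      have entry: "snd (v ! i) = snd ((a # w) ! i) \<and> fst (v ! i) \<in> case_nat U0 U i"
        if "i < Suc (length w)" for i
        using v that by simp
      have "word_value G e v' \<in> Q"
        using U(2) v'(2) entry[of "Suc _"] by (simp add: v'(1))
      moreover have "y \<in> U0" "d' = d"
        using entry[of 0] by (simp_all add: v'(1) a)
      ultimately have "(e y [^]\<^bsub>G\<^esub> d', word_value G e v') \<in> P \<times> Q"
        using U0P by simp
      from subsetD[OF PQ(5) this] show "word_value G e v \<in> N"
        by (simp add: v'(1) word_value_Cons)
    qed
  qed
qed

section \<open>Neighbourhoods in the free paratopological group\<close>

lemma continuous_map_in_free_group:
  assumes "free_paratopological_group X G T e"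
  shows "continuous_map X T e"
proof -
  have "embedding_map X T e" using assms by (simp add: free_paratopological_group_def)
  then show ?thesis
    unfolding embedding_map_def
    using continuous_map_in_subtopology homeomorphic_imp_continuous_map by blast
qed

text \<open>Inverse letters are ordered oppositely to the points. Exponents range over all integers,
  and at exponent 0 both directions are required so that \<open>letter_inv\<close> still reverses
  the order.\<close>

fun letter_le :: "('a \<Rightarrow> 'a \<Rightarrow> bool) \<Rightarrow> 'a \<times> int \<Rightarrow> 'a \<times> int \<Rightarrow> bool" where
  "letter_le R (x, d) (y, d') \<longleftrightarrow> d = d' \<and> (0 \<le> d \<longrightarrow> R x y) \<and> (d \<le> 0 \<longrightarrow> R y x)"

fun letter_inv :: "'a \<times> int \<Rightarrow> 'a \<times> int" where
  "letter_inv (x, d) = (x, - d)"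

lemma involutive_preorder_letters:
  assumes "reflp R" "transp R"
  shows "involutive_preorder (letter_le R) letter_inv"
proof
  fix a b c :: "'a \<times> int"
  show "letter_le R a a" using assms(1) by (cases a) (auto dest: reflpD)
  show "letter_inv (letter_inv a) = a" by (cases a) auto
  show "letter_le R (letter_inv b) (letter_inv a)" if "letter_le R a b"
    using that by (cases a; cases b) auto
  show "letter_le R a c" if "letter_le R a b" "letter_le R b c"
    using that assms(2) by (cases a; cases b; cases c) (auto dest: transpD)
qed

text \<open>Openness of the up-sets of \<open>R\<close> makes the map from x to the class of the
  one-letter word x continuous. Its extension \<open>h\<close> sends the value of each word
  \<open>v\<close> to \<open>up v\<close>, and \<open>N\<close> is the preimage of the smallest open
  set containing \<open>up w\<close>.\<close>

lemma openin_words_above: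
  assumes free: "free_paratopological_group X G T e"
    and R: "reflp R" "transp R"
    and open_up: "\<And>x. x \<in> topspace X \<Longrightarrow> openin X {y \<in> topspace X. R x y}"
    and w: "set w \<subseteq> topspace X \<times> {1, -1}"
  obtains N where "openin T N" "word_value G e w \<in> N"
    "\<forall>v. set v \<subseteq> topspace X \<times> {1, -1} \<longrightarrow> word_value G e v \<in> N \<longrightarrow>
       involutive_preorder.below (letter_le R) letter_inv w v"
proof -
  interpret L: involutive_preorder "letter_le R" letter_inv
    using R by (rule involutive_preorder_letters)
  interpret H: group L.word_group by (rule L.group_word_group)
  interpret G: group G
    using free by (simp add: free_paratopological_group_def paratopological_group_def)
  have T: "topspace T = carrier G" and e: "continuous_map X T e"
    using free continuous_map_in_free_group[OF free]
    by (auto simp: free_paratopological_group_def paratopological_group_def)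
  have ec: "e ` topspace X \<subseteq> carrier G"
    using e T by (auto simp: continuous_map_def)
  define f where "f = (\<lambda>x. L.up [(x, 1)])"
  have "openin X {x \<in> topspace X. f x \<in> W}" if W: "openin L.word_topology W" for W
  proof (subst openin_subopen, intro ballI)
    fix x assume x: "x \<in> {x \<in> topspace X. f x \<in> W}"
    have "f y \<in> W" if "R x y" for y
    proof -
      have "f y \<subseteq> f x"
        unfolding f_def L.up_subset_iff using that by (intro L.below_single) simp
      then show ?thesis using W x by (auto simp: L.openin_word_topology f_def)
    qed
    then show "\<exists>U. openin X U \<and> x \<in> U \<and> U \<subseteq> {x \<in> topspace X. f x \<in> W}"
      using x open_up[of x] reflpD[OF R(1), of x] by (intro exI[of _ "{y \<in> topspace X. R x y}"]) auto
  qed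
  then have "continuous_map X L.word_topology f"
    by (auto simp: continuous_map_def L.topspace_word_topology f_def)
  \<comment> \<open>The elements of \<open>L.word_group\<close> are sets of words, so the extension
    property is needed for a carrier of another type than in the definition.\<close>
  from free_paratopological_group_universal[OF free L.paratopological_word_group this]
  obtain h where h: "h \<in> hom G L.word_group" "continuous_map T L.word_topology h"
    and hf: "\<And>x. x \<in> topspace X \<Longrightarrow> h (e x) = f x" by blast
  interpret h: group_hom G L.word_group h
    by unfold_locales (rule h(1))
  have letter: "h (e x [^]\<^bsub>G\<^esub> d) = L.up [(x, d)]" if "x \<in> topspace X" "d \<in> {1, -1}" for x d
    using that ec hf[OF that(1)]
    by (auto simp: f_def L.inv_up L.inv_list_def G.int_pow_neg image_subset_iff)
  have val: "h (word_value G e v) = L.up v" if "set v \<subseteq> topspace X \<times> {1, -1}" for v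
    using that
  proof (induction v)
    case Nil
    then show ?case by (simp add: word_value_Nil L.one_word_group)
  next
    case (Cons a v)
    obtain x d where a: "a = (x, d)" by force
    have v: "set v \<subseteq> topspace X \<times> {1, -1}" and x: "x \<in> topspace X" and d: "d \<in> {1, -1}"
      using Cons.prems a by auto
    have "h (word_value G e (a # v)) = h (e x [^]\<^bsub>G\<^esub> d) \<otimes>\<^bsub>L.word_group\<^esub> h (word_value G e v)"
      using ec x word_value_closed[OF G.is_group ec v]
      by (simp add: a word_value_Cons image_subset_iff)
    then show ?case using Cons.IH[OF v] letter[OF x d] by (simp add: L.mult_up a)
  qed
  define N where "N = {g \<in> topspace T. h g \<in> {B \<in> range L.up. B \<subseteq> L.up w}}"
  show ?thesis
  proof (rule that[of N])
    show "openin T N"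
      unfolding N_def by (rule openin_continuous_map_preimage[OF h(2) L.openin_up])
    show "word_value G e w \<in> N"
      using val[OF w] word_value_closed[OF G.is_group ec w] by (simp add: N_def T)
    show "\<forall>v. set v \<subseteq> topspace X \<times> {1, -1} \<longrightarrow> word_value G e v \<in> N \<longrightarrow> L.below w v"
      using val by (simp add: N_def L.up_subset_iff)
  qed
qed

lemma word_neighbourhood_contains_open:
  assumes "t1_space X" and free: "free_paratopological_group X G T e"
    and red: "reduced_word X w"
    and V: "\<forall>i<length w. snd (w ! i) = 1 \<longrightarrow> openin X (V i) \<and> fst (w ! i) \<in> V i"
  obtains N where "openin T N" "word_value G e w \<in> N"
    "\<forall>v. reduced_word X v \<longrightarrow> length v \<le> length w \<longrightarrow> word_value G e v \<in> N \<longrightarrow>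
       length v = length w \<and> (\<forall>i<length w. snd (v ! i) = snd (w ! i) \<and>
         (snd (w ! i) = 1 \<longrightarrow> fst (v ! i) \<in> V i) \<and> (snd (w ! i) = -1 \<longrightarrow> fst (v ! i) = fst (w ! i)))"
proof -
  have w: "set w \<subseteq> topspace X \<times> {1, -1}" using red by (simp add: reduced_word_def)
  define F where "F = fst ` set w"
  define J where "J = {i. i < length w \<and> snd (w ! i) = 1}"
  define R where "R = (\<lambda>x y. (y \<in> F \<longrightarrow> y = x) \<and> (\<forall>i\<in>J. x \<in> V i \<longrightarrow> y \<in> V i))"
  have R: "reflp R" "transp R"
    unfolding R_def reflp_def transp_def by blast+
  interpret L: involutive_preorder "letter_le R" letter_inv
    using R by (rule involutive_preorder_letters)
  have open_up: "openin X {y \<in> topspace X. R x y}" if "x \<in> topspace X" for x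
  proof -
    have "F \<subseteq> topspace X" "finite F" using w by (auto simp: F_def)
    \<comment> \<open>The T1 axiom enters here: finite sets are closed.\<close>
    then have "closedin X (F - {x})"
      using assms(1) by (simp add: t1_space_closedin_finite finite_subset subset_iff)
    then have "openin X (topspace X - (F - {x}))" by blast
    moreover have "openin X ((topspace X - (F - {x})) \<inter> \<Inter> (V ` {i \<in> J. x \<in> V i}))"
    \<comment> \<open>Over an empty index set the intersection is \<open>UNIV\<close>, which need
      not be open in \<open>X\<close>.\<close>
    proof (cases "{i \<in> J. x \<in> V i} = {}")
      case True
      show ?thesis using calculation unfolding True by simp
    next
      case False
      have "openin X (\<Inter> (V ` {i \<in> J. x \<in> V i}))"
        using False V by (intro openin_Inter) (auto simp: J_def)
      then show ?thesis using calculation by blast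
    qed
    moreover have "{y \<in> topspace X. R x y}
        = (topspace X - (F - {x})) \<inter> \<Inter> (V ` {i \<in> J. x \<in> V i})"
      by (auto simp: R_def)
    ultimately show ?thesis by simp
  qed
  obtain N where N: "openin T N" "word_value G e w \<in> N"
    "\<forall>v. set v \<subseteq> topspace X \<times> {1, -1} \<longrightarrow> word_value G e v \<in> N \<longrightarrow> L.below w v"
    using openin_words_above[where R = R, OF free R open_up w] by blast
  have irred: "\<not> letter_le R c (letter_inv d)" if "w = s @ [c, d] @ t" for s c d t
  proof
    assume le: "letter_le R c (letter_inv d)"
    obtain x i y j where cd: "c = (x, i)" "d = (y, j)" by force
    have "x \<in> F" "y \<in> F" and ij: "i = 1 \<or> i = -1" using that cd w by (auto simp: F_def)
    \<comment> \<open>According to the sign \<open>i\<close>, either \<open>R x y\<close> or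
      \<open>R y x\<close> holds. Both points lie in \<open>F\<close>, so either one forces
      equality, and the two letters would cancel.\<close>
    then have "x = y" "i \<noteq> j" using le cd by (auto simp: R_def)
    moreover have "w ! length s = c" "w ! Suc (length s) = d" "Suc (length s) < length w"
      using that by (simp_all add: nth_append)
    then have "fst c = fst d \<longrightarrow> snd c = snd d"
      using red unfolding reduced_word_def by metis
    ultimately show False by (simp add: cd)
  qed
  show ?thesis
  proof (rule that[OF N(1,2)], intro allI impI)
    fix v assume v: "reduced_word X v" "length v \<le> length w" "word_value G e v \<in> N"
    then have "L.below w v" using N(3) by (simp add: reduced_word_def)
    then have le: "list_all2 (letter_le R) w v" using L.below_short v(2) irred by blast
    show "length v = length w \<and> (\<forall>i<length w. snd (v ! i) = snd (w ! i) \<and>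
         (snd (w ! i) = 1 \<longrightarrow> fst (v ! i) \<in> V i) \<and> (snd (w ! i) = -1 \<longrightarrow> fst (v ! i) = fst (w ! i)))"
    proof (intro conjI allI impI)
      show "length v = length w" using le by (simp add: list_all2_lengthD)
      fix i assume i: "i < length w"
      obtain x d y d' where xy: "w ! i = (x, d)" "v ! i = (y, d')" by force
      have l: "letter_le R (x, d) (y, d')" using list_all2_nthD[OF le i] xy by simp
      then show "snd (v ! i) = snd (w ! i)" using xy by simp
      show "fst (v ! i) \<in> V i" if "snd (w ! i) = 1"
        using l V that i xy by (auto simp: R_def J_def)
      \<comment> \<open>For an inverse letter the order gives \<open>R y x\<close>, and a point of
        \<open>F\<close> has only itself below it.\<close>
      have "x \<in> F" using i xy nth_mem[OF i] by (force simp: F_def)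
      then show "fst (v ! i) = fst (w ! i)" if "snd (w ! i) = -1"
        using l that xy by (auto simp: R_def)
    qed
  qed
qed

theorem theorem4p6:
  fixes X :: "'a topology" and FP :: "('b, 'm) monoid_scheme" and T :: "'b topology"
    and e :: "'a \<Rightarrow> 'b" and w :: "'a word" and n :: nat
  assumes "t1_space X"
    and "free_paratopological_group X FP T e"
    and "reduced_word X w" and "length w = n"
  shows "base_for_neighbourhood_system (subtopology T (FP_level X FP e n))
           (word_value FP e w) (word_neighbourhoods X FP e w)"
proof -
  have P: "paratopological_group FP T" and e: "continuous_map X T e"
    using assms(2) continuous_map_in_free_group[OF assms(2)]
    by (auto simp: free_paratopological_group_def)
  have grp: "group FP" and T: "topspace T = carrier FP"
    using P by (auto simp: paratopological_group_def)
  have ec: "e ` topspace X \<subseteq> carrier FP"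
    using e T by (auto simp: continuous_map_def)
  have w: "set w \<subseteq> topspace X \<times> {1, -1}" using assms(3) by (simp add: reduced_word_def)
  have sign: "snd (w ! i) = 1 \<or> snd (w ! i) = -1" and pt: "fst (w ! i) \<in> topspace X"
    if "i < length w" for i
    using subsetD[OF w nth_mem[OF that]] by (auto simp: mem_Times_iff)
  let ?Y = "subtopology T (FP_level X FP e n)"
  let ?V = "\<lambda>U. {v. length v = length w \<and>
         (\<forall>i<length w. snd (v ! i) = snd (w ! i) \<and> fst (v ! i) \<in> U i)}"
  let ?good = "\<lambda>U. \<forall>i < length w.
          (snd (w ! i) = 1 \<longrightarrow> is_neighbourhood X (fst (w ! i)) (U i)) \<and>
          (snd (w ! i) = -1 \<longrightarrow> U i = {fst (w ! i)})"
  have nbhds: "word_neighbourhoods X FP e w = {word_value FP e ` ?V U | U. ?good U}"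
    unfolding word_neighbourhoods_def set_list_product_word_values ..
  have wL: "word_value FP e w \<in> FP_level X FP e n"
    using assms(3,4) by (auto simp: FP_level_def)
  have level: "word_value FP e ` ?V U \<subseteq> topspace ?Y" if U: "?good U" for U
  proof clarify
    fix v assume v: "length v = length w"
      "\<forall>i<length w. snd (v ! i) = snd (w ! i) \<and> fst (v ! i) \<in> U i"
    have "v ! i \<in> topspace X \<times> {1, -1}" if "i < length v" for i
    proof -
      have i: "i < length w" using that v(1) by simp
      then have "U i \<subseteq> topspace X"
        using U sign[OF i] pt[OF i] by (auto simp: is_neighbourhood_def)
      then show ?thesis using sign[OF i] v(2) i by (auto simp: mem_Times_iff)
    qed
    then have sv: "set v \<subseteq> topspace X \<times> {1, -1}"
      by (metis in_set_conv_nth subsetI)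
    then have "word_value FP e v \<in> FP_level X FP e n"
      using word_value_in_level[OF grp ec] v(1) assms(4) by simp
    then show "word_value FP e v \<in> topspace ?Y"
      using word_value_closed[OF grp ec sv] by (simp add: T)
  qed
  show ?thesis
    unfolding base_for_neighbourhood_system_def nbhds
  proof (intro conjI ballI allI impI)
    fix B assume "B \<in> {word_value FP e ` ?V U | U. ?good U}"
    then obtain U where U: "?good U" and B: "B = word_value FP e ` ?V U" by blast
    \<comment> \<open>At inverse letters this interior may be empty; \<open>V\<close> is constrained
      only at positive letters.\<close>
    define V where "V = (\<lambda>i. X interior_of U i)"
    have V: "\<forall>i<length w. snd (w ! i) = 1 \<longrightarrow> openin X (V i) \<and> fst (w ! i) \<in> V i"
      using U by (auto simp: V_def is_neighbourhood_def openin_interior_of) (auto simp: interior_of_def)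
    have VU: "V i \<subseteq> U i" for i
      unfolding V_def by (rule interior_of_subset)
    obtain N where N: "openin T N" "word_value FP e w \<in> N"
      "\<forall>v. reduced_word X v \<longrightarrow> length v \<le> length w \<longrightarrow> word_value FP e v \<in> N \<longrightarrow>
       length v = length w \<and> (\<forall>i<length w. snd (v ! i) = snd (w ! i) \<and>
         (snd (w ! i) = 1 \<longrightarrow> fst (v ! i) \<in> V i) \<and> (snd (w ! i) = -1 \<longrightarrow> fst (v ! i) = fst (w ! i)))"
      by (rule word_neighbourhood_contains_open[OF assms(1-3) V])
    have "N \<inter> FP_level X FP e n \<subseteq> B"
    proof
      \<comment> \<open>Each element of the level is the value of a reduced word of length at most
        \<open>n\<close>, and \<open>N(3)\<close> compares that word with \<open>w\<close> letter by
        letter.\<close>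
      fix g assume g: "g \<in> N \<inter> FP_level X FP e n"
      then obtain v where v: "g = word_value FP e v" "reduced_word X v" "length v \<le> length w"
        using assms(4) by (auto simp: FP_level_def)
      have len: "length v = length w"
        using N(3) v g by simp
      have v': "snd (v ! i) = snd (w ! i)" "snd (w ! i) = 1 \<Longrightarrow> fst (v ! i) \<in> V i"
          "snd (w ! i) = -1 \<Longrightarrow> fst (v ! i) = fst (w ! i)" if "i < length w" for i
        using N(3) v g that by simp_all
      have "fst (v ! i) \<in> U i" if i: "i < length w" for i
        using sign[OF i] v'(2,3)[OF i] VU[of i] U i by auto
      then have "v \<in> ?V U" using len v'(1) by simp
      then show "g \<in> B" using v(1) B by blast
    qed
    moreover have "openin ?Y (N \<inter> FP_level X FP e n)"
      using N(1) by (auto simp: openin_subtopology)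
    ultimately show "is_neighbourhood ?Y (word_value FP e w) B"
      using level[OF U] N(2) wL unfolding is_neighbourhood_def B by blast
  next
    fix M assume "is_neighbourhood ?Y (word_value FP e w) M"
    then obtain N where N: "openin T N" "word_value FP e w \<in> N" "N \<inter> FP_level X FP e n \<subseteq> M"
      by (auto simp: is_neighbourhood_def openin_subtopology)
    \<comment> \<open>Continuity of multiplication yields a basic set inside \<open>N\<close>; by
      \<open>level\<close> it also lies in the subspace, hence in \<open>M\<close>.\<close>
    obtain U where U:
      "\<forall>i<length w. (snd (w ! i) = 1 \<longrightarrow> is_neighbourhood X (fst (w ! i)) (U i)) \<and>
         (snd (w ! i) = -1 \<longrightarrow> U i = {fst (w ! i)})"
      "\<forall>v. length v = length w \<and> (\<forall>i<length w. snd (v ! i) = snd (w ! i) \<and> fst (v ! i) \<in> U i)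
         \<longrightarrow> word_value FP e v \<in> N"
      using word_value_continuity[OF P e N(1,2) w] by blast
    have good: "?good U" by (rule U(1))
    have "word_value FP e ` ?V U \<subseteq> M"
      using level[OF good] U(2) N(3) by (auto simp: image_subset_iff)
    with good show "\<exists>B\<in>{word_value FP e ` ?V U | U. ?good U}. B \<subseteq> M" by blast
  qed
qed

end
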